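(* Let $\theta\in\mathsf{PTML}^2$ be a sentence in $\mathsf{FSNF}$ $\mathsf{DNF}$. Then $\theta$ is satisfiable if and only if $\theta$ is satisfiable in a model with a bounded number of agents, i.e. in a model whose set of agents is finite and of size bounded by a function of $\theta$ alone.
   Context: $\mathsf{PTML}^2$ is the two-variable propositional term modal logic: over a set of propositions and the two variables $x,y$, formulas are $\phi::= p \mid \neg\phi\mid\phi\land\phi\mid\phi\lor\phi\mid\exists z\,\phi\mid\forall z\,\phi\mid\Box_z\phi\mid\Diamond_z\phi$ with $z\in\{x,y\}$; a sentence has no free variables, where $\mathsf{Fv}(\Box_z\phi)=\mathsf{Fv}(\Diamond_z\phi)=\mathsf{Fv}(\phi)\cup\{z\}$. Models are $M=(W,D,\delta,R,\rho)$ with $W$ non-empty countable, $D$ a non-empty countable set of agents, $R\subseteq W\times D\times W$, $\delta:W\to2^D$ giving non-empty local domains with $(w,d,v)\in R\Rightarrow d\in\delta(w)\subseteq\delta(v)$, and $\rho(w)$ the set of propositions true at $w$. Semantics: $p$ holds at $w$ iff $p\in\rho(w)$; Booleans as usual; $\exists z\,\phi$ holds iff $\phi$ holds with $z$ assigned some $d\in\delta(w)$ (dually $\forall$); $\Box_z\phi$ holds iff $\phi$ holds at all $v$ with $(w,\sigma(z),v)\in R$ (dually $\Diamond_z$). A sentence is satisfiable if it holds at some world of some model. Formulas are in negation normal form. A literal is a proposition or its negation; a module is a literal or a formula $\Box_z\alpha$ or $\Diamond_z\alpha$. $\mathsf{C}(\phi)$: $\mathsf{C}(\phi)=\{\phi\}$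 if $\phi$ is a module or of the form $Qz\,\phi'$, $Q\in\{\forall,\exists\}$; $\mathsf{C}(\phi\odot\psi)=\mathsf{C}(\phi)\cup\mathsf{C}(\psi)$ for $\odot\in\{\land,\lor\}$. A formula is quantifier-safe if every member of $\mathsf{C}(\phi)$ is a module. Inductively: conjunctions of literals are $\mathsf{FSNF}$ conjunctions; disjunctions of $\mathsf{FSNF}$ conjunctions are in $\mathsf{FSNF}$ $\mathsf{DNF}$; a quantifier-safe $\phi$ such that for every $\Delta_z\psi\in\mathsf{C}(\phi)$, $\psi$ is in $\mathsf{FSNF}$ $\mathsf{DNF}$, is a quantifier-safe normal formula; and with literals $s_i$, formulas $\alpha^z,\beta^z_j$ in $\mathsf{FSNF}$ $\mathsf{DNF}$ and quantifier-safe normal formulas $\gamma^{z},\delta^{z}_k,\phi,\psi_l$, the formula $\bigwedge_{i\le a}s_i\land\bigwedge_{z\in\{x,y\}}(\Box_z\alpha^z\land\bigwedge_{j\le m_z}\Diamond_z\beta^z_j)\land\bigwedge_{z_1\in\{x,y\}}(\forall z_2\,\gamma^{z_1}\land\bigwedge_{k\le n_{z_1}}\exists z_2\,\delta^{z_1}_k)\land\forall x\forall y\,\phi\land\bigwedge_{l\le b}\forall x\exists y\,\psi_l$ is an $\mathsf{FSNF}$ conjunction ($z_2$ the variable other than $z_1$; all indices $\ge0$; the conjuncts $\Box_z\alpha^z$, $\forall z_2\gamma^{z_1}$, $\forall x\forall y\,\phi$ may be absent). *)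

theory Defs
  imports Main "HOL-Library.Multiset" "HOL-Library.Countable_Set"
begin

section \<open>Syntax\<close>

datatype var = X | Y

fun other :: "var \<Rightarrow> var" where
  "other X = Y"
| "other Y = X"

datatype 'p form =
    Prop 'p
  | Neg "'p form"
  | And "'p form" "'p form"
  | Or "'p form" "'p form"
  | Ex var "'p form"
  | All var "'p form"
  | Box var "'p form"
  | Dia var "'p form"

fun fv :: "'p form \<Rightarrow> var set" where
  "fv (Prop p) = {}"
| "fv (Neg \<phi>) = fv \<phi>"
| "fv (And \<phi> \<psi>) = fv \<phi> \<union> fv \<psi>"
| "fv (Or \<phi> \<psi>) = fv \<phi> \<union> fv \<psi>"
| "fv (Ex z \<phi>) = fv \<phi> - {z}"
| "fv (All z \<phi>) = fv \<phi> - {z}"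
| "fv (Box z \<phi>) = insert z (fv \<phi>)"
| "fv (Dia z \<phi>) = insert z (fv \<phi>)"

definition sentence :: "'p form \<Rightarrow> bool" where
  "sentence \<phi> \<longleftrightarrow> fv \<phi> = {}"

section \<open>Semantics\<close>

record ('w, 'd, 'p) model =
  worlds :: "'w set"
  agents :: "'d set"
  dom_at :: "'w \<Rightarrow> 'd set"
  acc :: "('w \<times> 'd \<times> 'w) set"
  val :: "'w \<Rightarrow> 'p set"

definition is_model :: "('w, 'd, 'p) model \<Rightarrow> bool" where
  "is_model M \<longleftrightarrow>
     worlds M \<noteq> {} \<and> countable (worlds M) \<and>
     agents M \<noteq> {} \<and> countable (agents M) \<and>
     acc M \<subseteq> worlds M \<times> agents M \<times> worlds M \<and>
     (\<forall>w\<in>worlds M. dom_at M w \<noteq> {} \<and> dom_at M w \<subseteq> agents M) \<and>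
     (\<forall>w d v. (w, d, v) \<in> acc M \<longrightarrow> d \<in> dom_at M w \<and> dom_at M w \<subseteq> dom_at M v)"

fun sat :: "('w, 'd, 'p) model \<Rightarrow> 'w \<Rightarrow> (var \<Rightarrow> 'd) \<Rightarrow> 'p form \<Rightarrow> bool" where
  "sat M w \<sigma> (Prop p) \<longleftrightarrow> p \<in> val M w"
| "sat M w \<sigma> (Neg \<phi>) \<longleftrightarrow> \<not> sat M w \<sigma> \<phi>"
| "sat M w \<sigma> (And \<phi> \<psi>) \<longleftrightarrow> sat M w \<sigma> \<phi> \<and> sat M w \<sigma> \<psi>"
| "sat M w \<sigma> (Or \<phi> \<psi>) \<longleftrightarrow> sat M w \<sigma> \<phi> \<or> sat M w \<sigma> \<psi>"
| "sat M w \<sigma> (Ex z \<phi>) \<longleftrightarrow> (\<exists>d\<in>dom_at M w. sat M w (\<sigma>(z := d)) \<phi>)"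
| "sat M w \<sigma> (All z \<phi>) \<longleftrightarrow> (\<forall>d\<in>dom_at M w. sat M w (\<sigma>(z := d)) \<phi>)"
| "sat M w \<sigma> (Box z \<phi>) \<longleftrightarrow> (\<forall>v. (w, \<sigma> z, v) \<in> acc M \<longrightarrow> sat M v \<sigma> \<phi>)"
| "sat M w \<sigma> (Dia z \<phi>) \<longleftrightarrow> (\<exists>v. (w, \<sigma> z, v) \<in> acc M \<and> sat M v \<sigma> \<phi>)"

text \<open>For a sentence the assignment is irrelevant, see \<open>sat_fv_cong\<close> below.\<close>

definition satisfied_in :: "('w, 'd, 'p) model \<Rightarrow> 'p form \<Rightarrow> bool" where
  "satisfied_in M \<theta> \<longleftrightarrow> (\<exists>w\<in>worlds M. \<exists>\<sigma>. range \<sigma> \<subseteq> agents M \<and> sat M w \<sigma> \<theta>)"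

text \<open>Worlds and agents form countable sets, so models may be taken over subsets of the natural
  numbers; the lemma \<open>nat_model_exists\<close> below shows that nothing is lost.\<close>

definition satisfiable :: "'p form \<Rightarrow> bool" where
  "satisfiable \<theta> \<longleftrightarrow> (\<exists>M :: (nat, nat, 'p) model. is_model M \<and> satisfied_in M \<theta>)"

definition satisfiable_agents_le :: "nat \<Rightarrow> 'p form \<Rightarrow> bool" where
  "satisfiable_agents_le n \<theta> \<longleftrightarrow>
     (\<exists>M :: (nat, nat, 'p) model. is_model M \<and> finite (agents M) \<and> card (agents M) \<le> n \<and>
        satisfied_in M \<theta>)"

lemma sat_fv_cong:
  "(\<And>z. z \<in> fv \<phi> \<Longrightarrow> \<sigma> z = \<tau> z) \<Longrightarrow> sat M w \<sigma> \<phi> \<longleftrightarrow> sat M w \<tau> \<phi>"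
proof (induction \<phi> arbitrary: w \<sigma> \<tau>)
  case (And \<phi> \<psi>)
  have "sat M w \<sigma> \<phi> = sat M w \<tau> \<phi>" by (rule And.IH(1)) (use And.prems in auto)
  moreover have "sat M w \<sigma> \<psi> = sat M w \<tau> \<psi>" by (rule And.IH(2)) (use And.prems in auto)
  ultimately show ?case by simp
next
  case (Or \<phi> \<psi>)
  have "sat M w \<sigma> \<phi> = sat M w \<tau> \<phi>" by (rule Or.IH(1)) (use Or.prems in auto)
  moreover have "sat M w \<sigma> \<psi> = sat M w \<tau> \<psi>" by (rule Or.IH(2)) (use Or.prems in auto)
  ultimately show ?case by simp
next
  case (Neg \<phi>)
  have "sat M w \<sigma> \<phi> = sat M w \<tau> \<phi>" by (rule Neg.IH) (use Neg.prems in auto)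
  then show ?case by simp
next
  case (Ex z \<phi>)
  have "sat M w (\<sigma>(z := d)) \<phi> = sat M w (\<tau>(z := d)) \<phi>" for d
    by (rule Ex.IH) (use Ex.prems in auto)
  then show ?case by simp
next
  case (All z \<phi>)
  have "sat M w (\<sigma>(z := d)) \<phi> = sat M w (\<tau>(z := d)) \<phi>" for d
    by (rule All.IH) (use All.prems in auto)
  then show ?case by simp
next
  case (Box z \<phi>)
  have "sat M v \<sigma> \<phi> = sat M v \<tau> \<phi>" for v
    by (rule Box.IH) (use Box.prems in auto)
  then show ?case using Box.prems by simp
next
  case (Dia z \<phi>)
  have "sat M v \<sigma> \<phi> = sat M v \<tau> \<phi>" for v
    by (rule Dia.IH) (use Dia.prems in auto)
  then show ?case using Dia.prems by simp
qed simp

lemma nat_model_exists: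
  fixes M :: "('w, 'd, 'p) model"
  assumes "is_model M" and "satisfied_in M \<theta>"
  shows "\<exists>M' :: (nat, nat, 'p) model.
    is_model M' \<and> satisfied_in M' \<theta> \<and> bij_betw (to_nat_on (agents M)) (agents M) (agents M')"
proof -
  define f where "f = to_nat_on (worlds M)"
  define g where "g = to_nat_on (agents M)"
  define h where "h = inv_into (worlds M) f"
  have injf: "inj_on f (worlds M)" and injg: "inj_on g (agents M)"
    using assms(1) by (auto simp: f_def g_def is_model_def)
  have hf: "h (f w) = w" if "w \<in> worlds M" for w
    using injf that by (simp add: h_def)
  define M' :: "(nat, nat, 'p) model" where
    "M' = \<lparr>worlds = f ` worlds M, agents = g ` agents M, dom_at = (\<lambda>n. g ` dom_at M (h n)),
           acc = (\<lambda>(w, d, v). (f w, g d, f v)) ` acc M, val = (\<lambda>n. val M (h n))\<rparr>"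
  have R: "w \<in> worlds M \<and> d \<in> agents M \<and> v \<in> worlds M \<and> d \<in> dom_at M w \<and> dom_at M w \<subseteq> dom_at M v"
    if "(w, d, v) \<in> acc M" for w d v
    using assms(1) that unfolding is_model_def by blast
  have dom: "dom_at M w \<subseteq> agents M" "dom_at M w \<noteq> {}" if "w \<in> worlds M" for w
    using assms(1) that unfolding is_model_def by blast+
  have M': "is_model M'"
    unfolding is_model_def
  proof (intro conjI ballI allI impI)
    show "worlds M' \<noteq> {}" "countable (worlds M')" "agents M' \<noteq> {}" "countable (agents M')"
      using assms(1) by (simp_all add: M'_def is_model_def)
    show "acc M' \<subseteq> worlds M' \<times> agents M' \<times> worlds M'"
      using R by (auto simp: M'_def)
  next
    fix n assume "n \<in> worlds M'"
    then obtain w where w: "w \<in> worlds M" "n = f w" by (auto simp: M'_def)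
    show "dom_at M' n \<noteq> {}" using dom[OF w(1)] w by (simp add: M'_def hf)
    show "dom_at M' n \<subseteq> agents M'" using dom[OF w(1)] w by (auto simp: M'_def hf)
  next
    fix n e m assume "(n, e, m) \<in> acc M'"
    then obtain w d v where v: "(w, d, v) \<in> acc M" "n = f w" "e = g d" "m = f v"
      by (auto simp: M'_def)
    show "e \<in> dom_at M' n" "dom_at M' n \<subseteq> dom_at M' m"
      using R[OF v(1)] v by (auto simp: M'_def hf)
  qed
  have acc': "(f w, g d, n) \<in> acc M' \<longleftrightarrow> (\<exists>v. n = f v \<and> (w, d, v) \<in> acc M)"
    if wd: "w \<in> worlds M" "d \<in> agents M" for w d n
  proof
    assume "(f w, g d, n) \<in> acc M'"
    then obtain w' d' v where v: "(w', d', v) \<in> acc M" "f w = f w'" "g d = g d'" "n = f v"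
      by (auto simp: M'_def)
    moreover have "w = w'" "d = d'"
      using v wd R[OF v(1)] injf injg by (auto dest: inj_onD)
    ultimately show "\<exists>v. n = f v \<and> (w, d, v) \<in> acc M" by blast
  next
    assume "\<exists>v. n = f v \<and> (w, d, v) \<in> acc M"
    then show "(f w, g d, n) \<in> acc M'" by (force simp: M'_def)
  qed
  have dom': "dom_at M' (f w) = g ` dom_at M w" if "w \<in> worlds M" for w
    using that by (simp add: M'_def hf)
  have S: "sat M' (f w) (g \<circ> \<sigma>) \<phi> \<longleftrightarrow> sat M w \<sigma> \<phi>"
    if "w \<in> worlds M" "range \<sigma> \<subseteq> agents M" for w \<sigma> \<phi>
    using that
  proof (induction \<phi> arbitrary: w \<sigma>)
    case (Prop p)
    then show ?case by (simp add: M'_def hf)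
  next
    case (Ex z \<phi>)
    have "sat M' (f w) ((g \<circ> \<sigma>)(z := g d)) \<phi> = sat M w (\<sigma>(z := d)) \<phi>" if "d \<in> dom_at M w" for d
      unfolding fun_upd_comp[symmetric]
      by (rule Ex.IH) (use Ex.prems that dom in auto)
    then show ?case unfolding sat.simps dom'[OF Ex.prems(1)] by blast
  next
    case (All z \<phi>)
    have "sat M' (f w) ((g \<circ> \<sigma>)(z := g d)) \<phi> = sat M w (\<sigma>(z := d)) \<phi>" if "d \<in> dom_at M w" for d
      unfolding fun_upd_comp[symmetric]
      by (rule All.IH) (use All.prems that dom in auto)
    then show ?case unfolding sat.simps dom'[OF All.prems(1)] by blast
  next
    case (Box z \<phi>)
    have z: "\<sigma> z \<in> agents M" using Box.prems by auto
    have "sat M' (f v) (g \<circ> \<sigma>) \<phi> = sat M v \<sigma> \<phi>" if "(w, \<sigma> z, v) \<in> acc M" for v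
      by (rule Box.IH) (use Box.prems R[OF that] in auto)
    then show ?case unfolding sat.simps comp_apply[of g \<sigma> z] acc'[OF Box.prems(1) z] by blast
  next
    case (Dia z \<phi>)
    have z: "\<sigma> z \<in> agents M" using Dia.prems by auto
    have "sat M' (f v) (g \<circ> \<sigma>) \<phi> = sat M v \<sigma> \<phi>" if "(w, \<sigma> z, v) \<in> acc M" for v
      by (rule Dia.IH) (use Dia.prems R[OF that] in auto)
    then show ?case unfolding sat.simps comp_apply[of g \<sigma> z] acc'[OF Dia.prems(1) z] by blast
  next
    case (Neg \<phi>)
    then show ?case by (simp only: sat.simps)
  next
    case (And \<phi> \<psi>)
    then show ?case by (simp only: sat.simps)
  next
    case (Or \<phi> \<psi>)
    then show ?case by (simp only: sat.simps)
  qed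
  obtain w \<sigma> where w: "w \<in> worlds M" "range \<sigma> \<subseteq> agents M" "sat M w \<sigma> \<theta>"
    using assms(2) by (auto simp: satisfied_in_def)
  have "f w \<in> worlds M'" "range (g \<circ> \<sigma>) \<subseteq> agents M'" "sat M' (f w) (g \<circ> \<sigma>) \<theta>"
    using w S[OF w(1,2), of \<theta>] by (auto simp: M'_def)
  then have "satisfied_in M' \<theta>" unfolding satisfied_in_def by blast
  moreover have "bij_betw g (agents M) (agents M')"
    using injg by (simp add: M'_def bij_betw_def)
  ultimately show ?thesis using M' unfolding g_def by blast
qed

section \<open>The normal form\<close>

fun literal :: "'p form \<Rightarrow> bool" where
  "literal (Prop p) \<longleftrightarrow> True"
| "literal (Neg (Prop p)) \<longleftrightarrow> True"
| "literal _ \<longleftrightarrow> False"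

definition is_module :: "'p form \<Rightarrow> bool" where
  "is_module \<phi> \<longleftrightarrow> literal \<phi> \<or> (\<exists>z \<alpha>. \<phi> = Box z \<alpha> \<or> \<phi> = Dia z \<alpha>)"

text \<open>On formulas in negation normal form, a negation reached by \<open>components\<close> is a literal. Any
  other negation is kept as a component, so that it is never quantifier-safe.\<close>

fun components :: "'p form \<Rightarrow> 'p form set" where
  "components (And \<phi> \<psi>) = components \<phi> \<union> components \<psi>"
| "components (Or \<phi> \<psi>) = components \<phi> \<union> components \<psi>"
| "components \<phi> = {\<phi>}"

definition quantifier_safe :: "'p form \<Rightarrow> bool" where
  "quantifier_safe \<phi> \<longleftrightarrow> (\<forall>\<psi>\<in>components \<phi>. is_module \<psi>)"

text \<open>Iterated conjunctions and disjunctions are read up to bracketing, conjunctions also up to the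
  order of the conjuncts. As there is no constant for truth or falsity, they are non-empty. No
  conjunct of an FSNF conjunction is itself a conjunction, and no FSNF conjunction is a disjunction,
  so splitting a formula at its outermost connectives is unambiguous.\<close>

fun conjuncts :: "'p form \<Rightarrow> 'p form multiset" where
  "conjuncts (And \<phi> \<psi>) = conjuncts \<phi> + conjuncts \<psi>"
| "conjuncts \<phi> = {#\<phi>#}"

fun disjuncts :: "'p form \<Rightarrow> 'p form set" where
  "disjuncts (Or \<phi> \<psi>) = disjuncts \<phi> \<union> disjuncts \<psi>"
| "disjuncts \<phi> = {\<phi>}"

text \<open>A conjunct that may be absent is given by an option.\<close>

fun opt_list :: "'a option \<Rightarrow> 'a list" where
  "opt_list None = []"
| "opt_list (Some a) = [a]"

text \<open>The conjuncts of the displayed form of an FSNF conjunction, from its parameters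
  \<open>s\<^sub>i\<close>, \<open>\<alpha>\<^sup>z\<close>, \<open>\<beta>\<^sup>z\<^sub>j\<close>, \<open>\<gamma>\<^sup>z\<close>, \<open>\<delta>\<^sup>z\<^sub>k\<close>, \<open>\<phi>\<close>, \<open>\<psi>\<^sub>l\<close>.\<close>

definition fsnf_conjunct_list ::
  "'p form list \<Rightarrow> (var \<Rightarrow> 'p form option) \<Rightarrow> (var \<Rightarrow> 'p form list) \<Rightarrow>
   (var \<Rightarrow> 'p form option) \<Rightarrow> (var \<Rightarrow> 'p form list) \<Rightarrow> 'p form option \<Rightarrow> 'p form list \<Rightarrow>
   'p form list" where
  "fsnf_conjunct_list s \<alpha> \<beta> \<gamma> \<delta> \<phi> \<psi> =
     s
     @ concat (map (\<lambda>z. map (Box z) (opt_list (\<alpha> z)) @ map (Dia z) (\<beta> z)) [X, Y])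
     @ concat (map (\<lambda>z. map (All (other z)) (opt_list (\<gamma> z)) @ map (Ex (other z)) (\<delta> z)) [X, Y])
     @ map (\<lambda>\<chi>. All X (All Y \<chi>)) (opt_list \<phi>)
     @ map (\<lambda>\<chi>. All X (Ex Y \<chi>)) \<psi>"

inductive fsnf_conj :: "'p form \<Rightarrow> bool"
  and fsnf_dnf :: "'p form \<Rightarrow> bool"
  and qs_normal :: "'p form \<Rightarrow> bool" where
  fsnf_conj_literals:
    "(\<And>s. s \<in># conjuncts \<chi> \<Longrightarrow> literal s) \<Longrightarrow> fsnf_conj \<chi>"
| fsnf_conj_step:
    "\<lbrakk>conjuncts \<chi> = mset (fsnf_conjunct_list s \<alpha> \<beta> \<gamma> \<delta> \<phi> \<psi>);
      \<And>l. l \<in> set s \<Longrightarrow> literal l;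
      \<And>z a. \<alpha> z = Some a \<Longrightarrow> fsnf_dnf a;
      \<And>z b. b \<in> set (\<beta> z) \<Longrightarrow> fsnf_dnf b;
      \<And>z c. \<gamma> z = Some c \<Longrightarrow> qs_normal c;
      \<And>z d. d \<in> set (\<delta> z) \<Longrightarrow> qs_normal d;
      \<And>e. \<phi> = Some e \<Longrightarrow> qs_normal e;
      \<And>h. h \<in> set \<psi> \<Longrightarrow> qs_normal h\<rbrakk>
     \<Longrightarrow> fsnf_conj \<chi>"
| fsnf_dnf_disj:
    "(\<And>\<chi>. \<chi> \<in> disjuncts \<theta> \<Longrightarrow> fsnf_conj \<chi>) \<Longrightarrow> fsnf_dnf \<theta>"
| qs_normal_intro:
    "\<lbrakk>quantifier_safe \<phi>;
      \<And>z \<psi>. Box z \<psi> \<in> components \<phi> \<Longrightarrow> fsnf_dnf \<psi>;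
      \<And>z \<psi>. Dia z \<psi> \<in> components \<phi> \<Longrightarrow> fsnf_dnf \<psi>\<rbrakk>
     \<Longrightarrow> qs_normal \<phi>"

end

theory Submission
  imports Defs "HOL-Library.FuncSet"
begin

text \<open>Since the bound may be any function of \<open>\<theta>\<close>, it suffices to turn a model \<open>M\<close> of \<open>\<theta>\<close> into one
  with finitely many agents. Write the type of an assignment at a world for the set of subformulas of
  \<open>\<theta>\<close> it satisfies there, and the 1-type of an agent \<open>a\<close> for the type of the pair \<open>(a, a)\<close> together with
  the set of types of all pairs \<open>(a, d)\<close>. There is no equality, and a formula sees at most two agents
  at a time. So a world can be replaced by any finite structure in which every agent has a 1-type
  occurring at the world: quantifiers depend on 1-types only.

  Such finite structures exist, as for first-order logic with two variables: three disjoint blocks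
  of fresh agents are arranged in a cycle, and every agent takes its witnesses in the next block, so
  that no pair of agents is asked for two types. The types between agents given beforehand can
  moreover be prescribed by a map into the local domain, and this yields successors: if \<open>e\<close> has the
  1-type of \<open>a\<close>, the present agents can be mapped to the local domain in such a way that \<open>e\<close> goes to
  \<open>a\<close> and all types of pairs with \<open>e\<close> are kept, and then any successor along \<open>a\<close> can be copied. One
  batch of fresh agents is needed for every level, and the modal depth of \<open>\<theta>\<close> bounds the levels.\<close>

section \<open>Pair types and 1-types\<close>

lemma other_other [simp]: "other (other z) = z"
  by (cases z) auto

lemma other_neq [simp]: "other z \<noteq> z" "z \<noteq> other z"
  by (cases z; simp)+

lemma other_iff: "y \<noteq> z \<longleftrightarrow> y = other z"
  by (cases y; cases z) auto

lemma UNIV_var: "UNIV = {X, Y}"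
  using var.exhaust by auto

lemma finite_var [simp]: "finite (UNIV :: var set)"
  by (simp add: UNIV_var)

definition pair_asg :: "var \<Rightarrow> 'a \<Rightarrow> 'a \<Rightarrow> var \<Rightarrow> 'a" where
  "pair_asg z a b = (\<lambda>y. if y = z then a else b)"

lemma pair_asg_other: "pair_asg (other z) a b = pair_asg z b a"
  by (rule ext) (auto simp: pair_asg_def dest: other_iff[THEN iffD1])

lemma pair_asg_self: "pair_asg z (\<sigma> z) (\<sigma> (other z)) = \<sigma>"
  by (rule ext) (auto simp: pair_asg_def dest: other_iff[THEN iffD1])

lemma pair_asg_same: "pair_asg z a a = (\<lambda>_. a)"
  by (simp add: pair_asg_def)

lemma pair_asg_upd: "(pair_asg (other z) a b)(z := c) = pair_asg (other z) a c"
  by (rule ext) (auto simp: pair_asg_def dest: other_iff[THEN iffD1])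

lemma comp_pair_asg: "h \<circ> pair_asg z a b = pair_asg z (h a) (h b)"
  by (auto simp: pair_asg_def)

lemma range_pair_asg: "range (pair_asg z a b) = {a, b}"
  by (cases z) (auto simp: pair_asg_def UNIV_var)

text \<open>A pair type is a function of the variable that holds \<open>a\<close>, so it records
  both orders of the pair (a, d); composing it with \<open>other\<close> gives the same pair seen
  from \<open>d\<close>.\<close>

definition pairs_of :: "((var \<Rightarrow> 'a) \<Rightarrow> 't) \<Rightarrow> 'a set \<Rightarrow> 'a \<Rightarrow> (var \<Rightarrow> 't) set" where
  "pairs_of F D a = (\<lambda>d z. F (pair_asg z a d)) ` D"

definition one_type :: "((var \<Rightarrow> 'a) \<Rightarrow> 't) \<Rightarrow> 'a set \<Rightarrow> 'a \<Rightarrow> 't \<times> (var \<Rightarrow> 't) set" where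
  "one_type F D a = (F (\<lambda>_. a), pairs_of F D a)"

lemma one_type_cong:
  assumes "\<And>\<sigma>. range \<sigma> \<subseteq> D \<Longrightarrow> F \<sigma> = G \<sigma>" "a \<in> D"
  shows "one_type F D a = one_type G D a"
proof -
  have "F (pair_asg z a d) = G (pair_asg z a d)" if "d \<in> D" for z d
    using assms that by (simp add: range_pair_asg)
  then have "pairs_of F D a = pairs_of G D a"
    by (auto simp: pairs_of_def image_def)
  moreover have "F (\<lambda>_. a) = G (\<lambda>_. a)" using assms by auto
  ultimately show ?thesis by (simp add: one_type_def)
qed

text \<open>\<open>wt e t\<close> is the agent that realises the pair type \<open>t\<close> for \<open>e\<close>; the label \<open>tag\<close> keeps the witnesses
  for different \<open>t\<close> apart, and asymmetry makes the assignment of pair types well defined.\<close>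

lemma realise_pairs:
  fixes F :: "(var \<Rightarrow> 'd) \<Rightarrow> 't" and h :: "'e \<Rightarrow> 'd"
  assumes h: "h ` E \<subseteq> D"
    and wt: "\<And>e t. e \<in> E \<Longrightarrow> t \<in> pairs_of F D (h e) \<Longrightarrow> wt e t \<in> E"
    and tag: "\<And>e t. e \<in> E \<Longrightarrow> t \<in> pairs_of F D (h e) \<Longrightarrow> tag (wt e t) = t"
    and swap: "\<And>e t. e \<in> E \<Longrightarrow> t \<in> pairs_of F D (h e) \<Longrightarrow>
      t \<circ> other \<in> pairs_of F D (h (wt e t))"
    and asym: "\<And>e f s t. f = wt e t \<Longrightarrow> e \<noteq> wt f s"
  obtains T where
    "\<And>e. e \<in> E \<Longrightarrow> one_type T E e = one_type F D (h e)"
    "\<And>e. T (\<lambda>_. e) = F (\<lambda>_. h e)"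
    "\<And>\<sigma>. (\<And>z e t. \<sigma> z \<noteq> wt e t) \<Longrightarrow> T \<sigma> = F (h \<circ> \<sigma>)"
proof -
  define wit where "wit e f \<longleftrightarrow> tag f \<in> pairs_of F D (h e) \<and> f = wt e (tag f)" for e f
  \<comment> \<open>A pair joined by \<open>wit\<close> gets the requested type, read off from the
    tag of the witness. All other pairs are pulled back along \<open>h\<close>, among them the
    diagonal and the pairs without any witness.\<close>
  define G where "G e f = (if wit e f then tag f else if wit f e then tag e \<circ> other
    else (\<lambda>z. F (pair_asg z (h e) (h f))))" for e f
  \<comment> \<open>Only the \<open>X\<close> component is read; by \<open>Gswap\<close> the
    \<open>Y\<close> component is the \<open>X\<close> component for the exchanged pair.\<close>
  define T where "T \<sigma> = G (\<sigma> X) (\<sigma> Y) X" for \<sigma>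
  have no2: "\<not> (wit e f \<and> wit f e)" for e f
    using asym unfolding wit_def by metis
  have Gswap: "G f e = G e f \<circ> other" for e f
    using no2[of e f] by (auto simp: G_def fun_eq_iff pair_asg_other)
  have TG: "T (pair_asg z e f) = G e f z" for z e f
    by (cases z) (simp_all add: T_def pair_asg_def Gswap[of f e])
  have diag: "T (\<lambda>_. e) = F (\<lambda>_. h e)" for e
    using no2[of e e] by (simp add: T_def G_def pair_asg_same)
  have sub: "G e f \<in> pairs_of F D (h e)" if "e \<in> E" "f \<in> E" for e f
  proof -
    consider "wit e f" | "\<not> wit e f" "wit f e" | "\<not> wit e f" "\<not> wit f e" by blast
    then show ?thesis
    proof cases
      case 1
      then show ?thesis by (simp add: G_def wit_def)
    next
      case 2
      then have "tag e \<circ> other \<in> pairs_of F D (h (wt f (tag e)))"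
        using swap that unfolding wit_def by blast
      then show ?thesis using 2 by (simp add: G_def wit_def)
    next
      case 3
      then show ?thesis using that h by (auto simp: G_def pairs_of_def)
    qed
  qed
  have sup: "t \<in> G e ` E" if "e \<in> E" "t \<in> pairs_of F D (h e)" for e t
  proof -
    have "wit e (wt e t)" using that tag by (simp add: wit_def)
    then have "G e (wt e t) = t" using tag that by (simp add: G_def)
    then show ?thesis using wt that by (metis imageI)
  qed
  show ?thesis
  proof
    show "one_type T E e = one_type F D (h e)" if "e \<in> E" for e
    proof -
      have "pairs_of T E e = G e ` E" by (simp add: pairs_of_def TG)
      then show ?thesis using sub sup that by (auto simp: one_type_def diag)
    qed
    show "T (\<lambda>_. e) = F (\<lambda>_. h e)" for e by (rule diag)
    show "T \<sigma> = F (h \<circ> \<sigma>)" if "\<And>z e t. \<sigma> z \<noteq> wt e t" for \<sigma>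
    proof -
      have "\<not> wit (\<sigma> X) (\<sigma> Y)" "\<not> wit (\<sigma> Y) (\<sigma> X)"
        using that unfolding wit_def by blast+
      then have "T \<sigma> = F (h \<circ> pair_asg X (\<sigma> X) (\<sigma> Y))"
        by (simp add: T_def G_def comp_pair_asg)
      then show ?thesis using pair_asg_self[of X \<sigma>] by simp
    qed
  qed
qed

section \<open>Fresh agents\<close>

text \<open>An agent records its level, its block, its 1-type, and the pair type it is a witness for.\<close>

type_synonym 't agent = "nat \<times> nat \<times> ('t \<times> (var \<Rightarrow> 't) set) \<times> (var \<Rightarrow> 't)"

text \<open>Levels accumulate because local domains can only grow along an edge. The labels range
  over all candidate types over \<open>V\<close>, realised or not, so the set does not depend on a
  model.\<close>

definition agents_upto :: "'t set \<Rightarrow> nat \<Rightarrow> 't agent set" where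
  "agents_upto V k =
     {..k} \<times> {..<3} \<times> (V \<times> Pow (PiE UNIV (\<lambda>_. V))) \<times> PiE UNIV (\<lambda>_. V)"

lemma finite_agents_upto: "finite V \<Longrightarrow> finite (agents_upto V k)"
  unfolding agents_upto_def by (intro finite_cartesian_product finite_PiE) (auto intro: finite_PiE)

lemma agents_upto_mono: "k \<le> l \<Longrightarrow> agents_upto V k \<subseteq> agents_upto V l"
  unfolding agents_upto_def by auto

lemma agents_upto_nonempty:
  assumes "V \<noteq> {}"
  shows "agents_upto V k \<noteq> {}"
proof -
  obtain c where "c \<in> V" using assms by blast
  then have "(0, 0, (c, {}), \<lambda>_. c) \<in> agents_upto V k" by (auto simp: agents_upto_def)
  then show ?thesis by blast
qed

text \<open>This is \<open>realise_pairs\<close> with \<open>h\<close> extended to the agents of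
  level \<open>k\<close> by their 1-type labels. Witnesses are taken only among these fresh agents,
  so pairs of older agents keep the types given by \<open>h\<close>.\<close>

lemma realise_level:
  fixes F :: "(var \<Rightarrow> 'd) \<Rightarrow> 't" and h :: "'t agent \<Rightarrow> 'd"
  assumes F: "\<And>\<sigma>. range \<sigma> \<subseteq> D \<Longrightarrow> F \<sigma> \<in> V" and D: "D \<noteq> {}"
    and h: "\<And>e. e \<in> agents_upto V k \<Longrightarrow> fst e < k \<Longrightarrow> h e \<in> D"
  obtains T h' where
    "h' ` agents_upto V k \<subseteq> D"
    "\<And>e. e \<in> agents_upto V k \<Longrightarrow> one_type T (agents_upto V k) e = one_type F D (h' e)"
    "\<And>e. T (\<lambda>_. e) = F (\<lambda>_. h' e)"
    "\<And>\<sigma>. (\<And>z. fst (\<sigma> z) < k) \<Longrightarrow> T \<sigma> = F (h \<circ> \<sigma>)"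
proof -
  let ?E = "agents_upto V k"
  \<comment> \<open>A label that is not a 1-type of \<open>F\<close> on \<open>D\<close> gets an
    arbitrary agent of \<open>D\<close>, so every label yields some genuine 1-type.\<close>
  define rep where "rep \<tau> = (if \<tau> \<in> one_type F D ` D then SOME d. d \<in> D \<and> one_type F D d = \<tau>
    else SOME d. d \<in> D)" for \<tau>
  have rep: "rep (one_type F D d) \<in> D \<and> one_type F D (rep (one_type F D d)) = one_type F D d"
    if "d \<in> D" for d
    using that someI[of "\<lambda>d'. d' \<in> D \<and> one_type F D d' = one_type F D d" d] by (auto simp: rep_def)
  have repD: "rep \<tau> \<in> D" for \<tau>
  proof (cases "\<tau> \<in> one_type F D ` D")
    case False
    then show ?thesis using D by (simp add: rep_def some_in_eq)
  qed (use rep in auto)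
  define h' where "h' e = (if fst e < k then h e else rep (fst (snd (snd e))))" for e
  \<comment> \<open>An older agent is never a witness, so its requests may all go to block 0; a
    fresh agent asks the next of the three blocks.\<close>
  define nxt where "nxt e = (if fst e < k then 0 else Suc (fst (snd e)) mod 3)" for e :: "'t agent"
  define wit where "wit a t = (SOME d. d \<in> D \<and> t = (\<lambda>z. F (pair_asg z a d)))" for a t
  have wit: "wit a t \<in> D \<and> t = (\<lambda>z. F (pair_asg z a (wit a t)))" if "t \<in> pairs_of F D a" for a t
    unfolding wit_def by (rule someI_ex) (use that in \<open>auto simp: pairs_of_def\<close>)
  \<comment> \<open>The label is the 1-type of a real witness in \<open>D\<close>. \<open>h'\<close>
    may map the new agent to another element, but one with the same 1-type, which is enough for the
    reversed pair type to occur there.\<close>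
  define wt where "wt e t = (k, nxt e, one_type F D (wit (h' e) t), t)" for e t
  define tag where "tag e = snd (snd (snd e))" for e :: "'t agent"
  have h'D: "h' ` ?E \<subseteq> D" using h repD by (auto simp: h'_def)
  have pairV: "(\<lambda>z. F (pair_asg z a d)) \<in> PiE UNIV (\<lambda>_. V)" if "a \<in> D" "d \<in> D" for a d
    using F that by (auto simp: range_pair_asg)
  have typeV: "one_type F D a \<in> V \<times> Pow (PiE UNIV (\<lambda>_. V))" if "a \<in> D" for a
    using F[of "\<lambda>_. a"] pairV that by (auto simp: one_type_def pairs_of_def)
  show ?thesis
  proof (rule realise_pairs[OF h'D, where F = F and wt = wt and tag = tag])
    fix e t assume e: "e \<in> ?E" "t \<in> pairs_of F D (h' e)"
    let ?d = "wit (h' e) t"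
    have d: "?d \<in> D" "t = (\<lambda>z. F (pair_asg z (h' e) ?d))" using wit[OF e(2)] by blast+
    have eD: "h' e \<in> D" using e h'D by auto
    have "nxt e < 3" by (simp add: nxt_def)
    moreover have "t \<in> PiE UNIV (\<lambda>_. V)" using pairV[OF eD d(1)] d(2) by simp
    ultimately show "wt e t \<in> ?E"
      using typeV[OF d(1)] unfolding wt_def agents_upto_def by blast
    show "tag (wt e t) = t" by (simp add: tag_def wt_def)
    have "h' (wt e t) = rep (one_type F D ?d)" by (simp add: h'_def wt_def)
    then have "pairs_of F D (h' (wt e t)) = pairs_of F D ?d"
      using rep[OF d(1)] by (simp add: one_type_def)
    moreover have "t \<circ> other = (\<lambda>z. F (pair_asg z ?d (h' e)))"
      by (subst d(2)) (simp add: fun_eq_iff pair_asg_other)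
    ultimately show "t \<circ> other \<in> pairs_of F D (h' (wt e t))"
      using eD by (auto simp: pairs_of_def)
  next
    fix e f s t assume f: "f = wt e t"
    show "e \<noteq> wt f s"
    proof
      assume e: "e = wt f s"
      have wt': "fst (wt a b) = k" "fst (snd (wt a b)) = nxt a" for a b by (simp_all add: wt_def)
      have "fst f = k" "fst e = k" using wt'(1) e f by metis+
      moreover have "fst (snd f) = nxt e" "fst (snd e) = nxt f" using wt'(2) e f by metis+
      ultimately have "fst (snd f) = Suc (fst (snd e)) mod 3" "fst (snd e) = Suc (fst (snd f)) mod 3"
        by (simp_all only: nxt_def less_irrefl if_False)
      \<comment> \<open>Mutual witnesses would force a block number b to equal b + 2 modulo 3; two
        blocks would not exclude this.\<close>
      then show False by presburger
    qed
  next
    fix T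
    assume T: "\<And>e. e \<in> ?E \<Longrightarrow> one_type T ?E e = one_type F D (h' e)"
      "\<And>e. T (\<lambda>_. e) = F (\<lambda>_. h' e)"
      "\<And>\<sigma>. (\<And>z e t. \<sigma> z \<noteq> wt e t) \<Longrightarrow> T \<sigma> = F (h' \<circ> \<sigma>)"
    have "T \<sigma> = F (h \<circ> \<sigma>)" if "\<And>z. fst (\<sigma> z) < k" for \<sigma>
    proof -
      have "\<sigma> z \<noteq> wt e t" for z e t using that[of z] by (auto simp: wt_def)
      moreover have "h' \<circ> \<sigma> = h \<circ> \<sigma>" using that by (auto simp: h'_def)
      ultimately show ?thesis using T(3)[of \<sigma>] by simp
    qed
    then show thesis using that h'D T by blast
  qed
qed

section \<open>The model of types\<close>

fun subforms :: "'p form \<Rightarrow> 'p form set" where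
  "subforms (Prop p) = {Prop p}"
| "subforms (Neg \<phi>) = insert (Neg \<phi>) (subforms \<phi>)"
| "subforms (And \<phi> \<psi>) = insert (And \<phi> \<psi>) (subforms \<phi> \<union> subforms \<psi>)"
| "subforms (Or \<phi> \<psi>) = insert (Or \<phi> \<psi>) (subforms \<phi> \<union> subforms \<psi>)"
| "subforms (Ex z \<phi>) = insert (Ex z \<phi>) (subforms \<phi>)"
| "subforms (All z \<phi>) = insert (All z \<phi>) (subforms \<phi>)"
| "subforms (Box z \<phi>) = insert (Box z \<phi>) (subforms \<phi>)"
| "subforms (Dia z \<phi>) = insert (Dia z \<phi>) (subforms \<phi>)"

lemma finite_subforms [simp]: "finite (subforms \<phi>)"
  by (induction \<phi>) auto

lemma subforms_refl [simp]: "\<phi> \<in> subforms \<phi>"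
  by (cases \<phi>) auto

lemma subforms_trans: "\<psi> \<in> subforms \<phi> \<Longrightarrow> \<chi> \<in> subforms \<psi> \<Longrightarrow> \<chi> \<in> subforms \<phi>"
  by (induction \<phi>) auto

fun modal_depth :: "'p form \<Rightarrow> nat" where
  "modal_depth (Prop p) = 0"
| "modal_depth (Neg \<phi>) = modal_depth \<phi>"
| "modal_depth (And \<phi> \<psi>) = max (modal_depth \<phi>) (modal_depth \<psi>)"
| "modal_depth (Or \<phi> \<psi>) = max (modal_depth \<phi>) (modal_depth \<psi>)"
| "modal_depth (Ex z \<phi>) = modal_depth \<phi>"
| "modal_depth (All z \<phi>) = modal_depth \<phi>"
| "modal_depth (Box z \<phi>) = Suc (modal_depth \<phi>)"
| "modal_depth (Dia z \<phi>) = Suc (modal_depth \<phi>)"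

section \<open>Type worlds, their edges and the resulting model\<close>

locale finite_agents =
  fixes M :: "('w, 'd, 'p) model" and \<theta> :: "'p form"
  assumes is_model: "is_model M"
begin

abbreviation \<Gamma> :: "'p form set" where "\<Gamma> \<equiv> subforms \<theta>"

definition tp :: "'w \<Rightarrow> (var \<Rightarrow> 'd) \<Rightarrow> 'p form set" where
  "tp w \<sigma> = {\<chi> \<in> \<Gamma>. sat M w \<sigma> \<chi>}"

abbreviation level :: "nat \<Rightarrow> 'p form set agent set" where
  "level k \<equiv> agents_upto (Pow \<Gamma>) k"

text \<open>Every agent of the level must look like some agent at \<open>w\<close>; the converse is
  not demanded, since a quantifier evaluated at an agent sees only the pair types in its
  1-type.\<close>

definition mirrors :: "nat \<Rightarrow> ((var \<Rightarrow> 'p form set agent) \<Rightarrow> 'p form set) \<Rightarrow> 'w \<Rightarrow> bool" where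
  "mirrors k T w \<longleftrightarrow> w \<in> worlds M \<and>
     (\<forall>e\<in>level k. \<exists>a\<in>dom_at M w. one_type T (level k) e = one_type (tp w) (dom_at M w) a)"

text \<open>Extensionality of \<open>T\<close> leaves only finitely many worlds.\<close>

definition type_worlds :: "(nat \<times> ((var \<Rightarrow> 'p form set agent) \<Rightarrow> 'p form set)) set" where
  "type_worlds =
     {(k, T). k \<le> modal_depth \<theta> \<and> T \<in> PiE (PiE UNIV (\<lambda>_. level k)) (\<lambda>_. Pow \<Gamma>) \<and>
       (\<exists>w. mirrors k T w)}"

text \<open>As in a largest filtration, an edge to the next level exists unless a box or diamond
  formula excludes it. Both conditions are stated because \<open>subforms\<close> is not closed
  under duals. They concern only assignments that use \<open>e\<close>, since an edge for
  \<open>e\<close> interprets modalities at no others.\<close>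

definition type_acc where
  "type_acc = {((k, T), e, (l, U)). (k, T) \<in> type_worlds \<and> (l, U) \<in> type_worlds \<and> l = Suc k \<and> e \<in> level k \<and>
     (\<forall>z \<sigma>. range \<sigma> \<subseteq> level k \<longrightarrow> \<sigma> z = e \<longrightarrow>
        (\<forall>\<chi>. Box z \<chi> \<in> T \<sigma> \<longrightarrow> \<chi> \<in> U \<sigma>) \<and> (\<forall>\<chi>. Dia z \<chi> \<in> \<Gamma> \<longrightarrow> \<chi> \<in> U \<sigma> \<longrightarrow> Dia z \<chi> \<in> T \<sigma>))}"

text \<open>All \<open>T \<sigma>\<close> of a type world come from one world of \<open>M\<close>
  and so contain the same propositions; the existential in \<open>val\<close> is therefore
  independent of the assignment.\<close>

definition type_model where
  "type_model = \<lparr>worlds = type_worlds, agents = level (modal_depth \<theta>), dom_at = (\<lambda>(k, T). level k),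
     acc = type_acc, val = (\<lambda>(k, T). {p. \<exists>\<sigma>. range \<sigma> \<subseteq> level k \<and> Prop p \<in> T \<sigma>})\<rparr>"

lemma type_model_simps:
  "worlds type_model = type_worlds" "agents type_model = level (modal_depth \<theta>)"
  "dom_at type_model (k, T) = level k" "acc type_model = type_acc"
  by (simp_all add: type_model_def)

lemma level_nonempty: "level k \<noteq> {}"
  by (rule agents_upto_nonempty) auto

lemma finite_type_worlds: "finite type_worlds"
proof -
  have "type_worlds \<subseteq> (SIGMA k : {..modal_depth \<theta>}. PiE (PiE UNIV (\<lambda>_. level k)) (\<lambda>_. Pow \<Gamma>))"
    by (auto simp: type_worlds_def)
  moreover have "finite \<dots>"
    by (intro finite_SigmaI finite_PiE) (auto intro!: finite_PiE finite_agents_upto)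
  ultimately show ?thesis by (rule finite_subset)
qed

section \<open>Passing between a level and a local domain\<close>

lemma range_PiE: "\<sigma> \<in> PiE UNIV (\<lambda>_. D) \<longleftrightarrow> range \<sigma> \<subseteq> D"
  by auto

text \<open>\<open>e\<close> shares the 1-type of some agent \<open>a\<close>. One inclusion between
  their sets of pair types yields a partner in the domain for each agent of the level, the other
  gives the last clause.\<close>

lemma matching_map:
  assumes w: "mirrors k T w" and e: "e \<in> level k"
  obtains h where "h ` level k \<subseteq> dom_at M w"
    "\<And>\<sigma> z. range \<sigma> \<subseteq> level k \<Longrightarrow> \<sigma> z = e \<Longrightarrow> T \<sigma> = tp w (h \<circ> \<sigma>)"
    "\<And>d. d \<in> dom_at M w \<Longrightarrow> \<exists>g\<in>level k. \<forall>z. T (pair_asg z e g) = tp w (pair_asg z (h e) d)"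
proof -
  obtain a where a: "a \<in> dom_at M w" "T (\<lambda>_. e) = tp w (\<lambda>_. a)"
    "pairs_of T (level k) e = pairs_of (tp w) (dom_at M w) a"
    using assms unfolding mirrors_def one_type_def by blast
  have "\<exists>d\<in>dom_at M w. \<forall>z. T (pair_asg z e g) = tp w (pair_asg z a d)" if "g \<in> level k" for g
  proof -
    have "(\<lambda>z. T (pair_asg z e g)) \<in> pairs_of (tp w) (dom_at M w) a"
      using that a(3)[symmetric] by (auto simp: pairs_of_def)
    then show ?thesis by (auto simp: pairs_of_def fun_eq_iff)
  qed
  then obtain h where h: "\<And>g. g \<in> level k \<Longrightarrow> h g \<in> dom_at M w"
    "\<And>g z. g \<in> level k \<Longrightarrow> T (pair_asg z e g) = tp w (pair_asg z a (h g))"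
    by metis
  have from_M: "\<exists>g\<in>level k. \<forall>z. T (pair_asg z e g) = tp w (pair_asg z a d)" if "d \<in> dom_at M w" for d
  proof -
    have "(\<lambda>z. tp w (pair_asg z a d)) \<in> pairs_of T (level k) e"
      unfolding a(3) using that by (auto simp: pairs_of_def)
    then show ?thesis by (auto simp: pairs_of_def fun_eq_iff)
  qed
  show ?thesis
  proof
    \<comment> \<open>The partner chosen for \<open>e\<close> itself need not be \<open>a\<close>;
      redirecting \<open>e\<close> to \<open>a\<close> is correct on the diagonal because a 1-type
      records the type of the pair (a, a).\<close>
    show "(h(e := a)) ` level k \<subseteq> dom_at M w" using h(1) a(1) by auto
    show "\<exists>g\<in>level k. \<forall>z. T (pair_asg z e g) = tp w (pair_asg z ((h(e := a)) e) d)"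
      if "d \<in> dom_at M w" for d
      using from_M[OF that] by simp
    show "T \<sigma> = tp w (h(e := a) \<circ> \<sigma>)" if "range \<sigma> \<subseteq> level k" "\<sigma> z = e" for \<sigma> z
    proof (cases "\<sigma> (other z) = e")
      case True
      then have "\<sigma> = (\<lambda>_. e)" using pair_asg_self[of z \<sigma>] that by (simp add: pair_asg_same)
      then show ?thesis using a(2) by (simp add: comp_def)
    next
      case False
      have \<sigma>: "\<sigma> = pair_asg z e (\<sigma> (other z))" using pair_asg_self[of z \<sigma>] that by simp
      have "h(e := a) \<circ> \<sigma> = pair_asg z a (h (\<sigma> (other z)))"
        using False by (subst \<sigma>) (simp add: comp_pair_asg)
      moreover have "T \<sigma> = tp w (pair_asg z a (h (\<sigma> (other z))))"
        using h(2)[of "\<sigma> (other z)" z] that(1) \<sigma> by auto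
      ultimately show ?thesis by simp
    qed
  qed
qed

text \<open>This is \<open>realise_level\<close> for the types at \<open>w\<close>. The prescribed
  map \<open>h\<close> serves for successors, whose older agents already have images.\<close>

lemma world_exists:
  assumes w: "w \<in> worlds M" and k: "k \<le> modal_depth \<theta>"
    and h: "\<And>e. e \<in> level k \<Longrightarrow> fst e < k \<Longrightarrow> h e \<in> dom_at M w"
  obtains T h' where "(k, T) \<in> type_worlds" "h' ` level k \<subseteq> dom_at M w"
    "\<And>e. e \<in> level k \<Longrightarrow> T (\<lambda>_. e) = tp w (\<lambda>_. h' e)"
    "\<And>\<sigma>. range \<sigma> \<subseteq> level k \<Longrightarrow> (\<And>z. fst (\<sigma> z) < k) \<Longrightarrow> T \<sigma> = tp w (h \<circ> \<sigma>)"
proof -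
  have "dom_at M w \<noteq> {}" using is_model w by (simp add: is_model_def)
  moreover have tpV: "tp w \<sigma> \<in> Pow \<Gamma>" for \<sigma> by (auto simp: tp_def)
  ultimately obtain T h' where T: "h' ` level k \<subseteq> dom_at M w"
    "\<And>e. e \<in> level k \<Longrightarrow> one_type T (level k) e = one_type (tp w) (dom_at M w) (h' e)"
    "\<And>e. T (\<lambda>_. e) = tp w (\<lambda>_. h' e)"
    "\<And>\<sigma>. (\<And>z. fst (\<sigma> z) < k) \<Longrightarrow> T \<sigma> = tp w (h \<circ> \<sigma>)"
    using realise_level[of "dom_at M w" "tp w" "Pow \<Gamma>" k h] h by metis
  let ?T = "restrict T (PiE UNIV (\<lambda>_. level k))"
  have eq: "?T \<sigma> = T \<sigma>" if "range \<sigma> \<subseteq> level k" for \<sigma> using that by (simp only: restrict_def range_PiE if_True)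
  have ot: "one_type ?T (level k) e = one_type (tp w) (dom_at M w) (h' e)" if "e \<in> level k" for e
    using one_type_cong[of "level k" ?T T e] eq T(2) that by simp
  \<comment> \<open>This is read off from the 1-type of \<open>\<sigma> X\<close>, all of whose pair
    types occur at \<open>w\<close>.\<close>
  have "T \<sigma> \<in> Pow \<Gamma>" if "range \<sigma> \<subseteq> level k" for \<sigma>
  proof -
    have X: "\<sigma> X \<in> level k" "\<sigma> Y \<in> level k" using that by auto
    have "(\<lambda>z. T (pair_asg z (\<sigma> X) (\<sigma> Y))) \<in> pairs_of T (level k) (\<sigma> X)"
      using X by (auto simp: pairs_of_def)
    then have "(\<lambda>z. T (pair_asg z (\<sigma> X) (\<sigma> Y))) \<in> pairs_of (tp w) (dom_at M w) (h' (\<sigma> X))"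
      using T(2)[OF X(1)] by (simp add: one_type_def)
    then obtain d where "T (pair_asg X (\<sigma> X) (\<sigma> Y)) = tp w (pair_asg X (h' (\<sigma> X)) d)"
      by (auto simp: pairs_of_def fun_eq_iff)
    then show ?thesis using tpV pair_asg_self[of X \<sigma>] by simp
  qed
  then have "?T \<in> PiE (PiE UNIV (\<lambda>_. level k)) (\<lambda>_. Pow \<Gamma>)"
    unfolding restrict_PiE_iff range_PiE by blast
  moreover have "mirrors k ?T w"
    unfolding mirrors_def using w T(1) ot by (meson image_subset_iff)
  ultimately have "(k, ?T) \<in> type_worlds" using k unfolding type_worlds_def by blast
  moreover have "?T (\<lambda>_. e) = tp w (\<lambda>_. h' e)" if "e \<in> level k" for e
    using that T(3) eq[of "\<lambda>_. e"] by auto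
  ultimately show ?thesis using that[of ?T h'] T(1,4) eq by simp
qed

section \<open>Connectives, quantifiers and modalities in type worlds\<close>

lemma mirrored_world:
  assumes "(k, T) \<in> type_worlds"
  obtains w where "mirrors k T w"
  using assms by (auto simp: type_worlds_def)

text \<open>A value of \<open>T\<close> is the type of an actual assignment, so it respects the
  Boolean connectives; the world \<open>w\<close> is the same for all \<open>\<sigma>\<close>, which
  the case of propositions uses.\<close>

lemma mirrors_realises:
  assumes "mirrors k T w" "range \<sigma> \<subseteq> level k"
  obtains \<tau> where "T \<sigma> = tp w \<tau>"
proof -
  have "\<sigma> X \<in> level k" using assms(2) by auto
  from matching_map[OF assms(1) this] show ?thesis using that assms(2) by metis
qed

text \<open>Binding \<open>z\<close> leaves only the agent at \<open>other z\<close> in view.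
  \<open>matching_map\<close> for this agent shows that the level and the local domain offer the
  same types when \<open>z\<close> is reassigned.\<close>

lemma quantifier_step:
  assumes T: "(k, T) \<in> type_worlds" and \<sigma>: "range \<sigma> \<subseteq> level k"
    and \<chi>: "\<chi> \<in> \<Gamma>"
  shows "Ex z \<chi> \<in> \<Gamma> \<Longrightarrow> Ex z \<chi> \<in> T \<sigma> \<longleftrightarrow> (\<exists>g\<in>level k. \<chi> \<in> T (\<sigma>(z := g)))"
    and "All z \<chi> \<in> \<Gamma> \<Longrightarrow> All z \<chi> \<in> T \<sigma> \<longleftrightarrow> (\<forall>g\<in>level k. \<chi> \<in> T (\<sigma>(z := g)))"
proof -
  obtain w where w: "mirrors k T w"
    using mirrored_world[OF T] .
  let ?e = "\<sigma> (other z)"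
  have e: "?e \<in> level k" using \<sigma> by auto
  obtain h where h: "h ` level k \<subseteq> dom_at M w"
    "\<And>\<sigma>' y. range \<sigma>' \<subseteq> level k \<Longrightarrow> \<sigma>' y = ?e \<Longrightarrow> T \<sigma>' = tp w (h \<circ> \<sigma>')"
    "\<And>d. d \<in> dom_at M w \<Longrightarrow> \<exists>g\<in>level k. \<forall>y. T (pair_asg y ?e g) = tp w (pair_asg y (h ?e) d)"
    by (rule matching_map[OF w e]) blast
  have \<sigma>_eq: "\<sigma> = pair_asg (other z) ?e (\<sigma> z)" using pair_asg_self[of "other z" \<sigma>] by simp
  have upd: "\<sigma>(z := g) = pair_asg (other z) ?e g" for g
    by (subst \<sigma>_eq) (rule pair_asg_upd)
  have upd': "(h \<circ> \<sigma>)(z := d) = pair_asg (other z) (h ?e) d" for d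
    by (subst \<sigma>_eq) (simp add: comp_pair_asg pair_asg_upd)
  have to_M: "T (\<sigma>(z := g)) = tp w ((h \<circ> \<sigma>)(z := h g))" if "g \<in> level k" for g
  proof -
    have "range (\<sigma>(z := g)) \<subseteq> level k" using \<sigma> that by auto
    then have "T (\<sigma>(z := g)) = tp w (h \<circ> \<sigma>(z := g))" using h(2)[of "\<sigma>(z := g)" "other z"] by simp
    then show ?thesis by (simp add: fun_upd_comp)
  qed
  have from_M: "\<exists>g\<in>level k. T (\<sigma>(z := g)) = tp w ((h \<circ> \<sigma>)(z := d))" if "d \<in> dom_at M w" for d
    using h(3)[OF that] unfolding upd upd' by blast
  have T\<sigma>: "T \<sigma> = tp w (h \<circ> \<sigma>)" using h(2)[OF \<sigma>, of "other z"] by simp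
  have in_tp: "\<chi> \<in> tp w \<tau> \<longleftrightarrow> sat M w \<tau> \<chi>" for \<tau> using \<chi> by (simp add: tp_def)
  have hD: "h g \<in> dom_at M w" if "g \<in> level k" for g using h(1) that by auto
  have types: "(\<lambda>g. T (\<sigma>(z := g))) ` level k = (\<lambda>d. tp w ((h \<circ> \<sigma>)(z := d))) ` dom_at M w"
  proof (intro equalityI image_subsetI)
    show "T (\<sigma>(z := g)) \<in> (\<lambda>d. tp w ((h \<circ> \<sigma>)(z := d))) ` dom_at M w" if "g \<in> level k" for g
      unfolding to_M[OF that] using hD[OF that] by (rule imageI)
    show "tp w ((h \<circ> \<sigma>)(z := d)) \<in> (\<lambda>g. T (\<sigma>(z := g))) ` level k" if "d \<in> dom_at M w" for d
      using from_M[OF that] by (metis imageI)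
  qed
  show "Ex z \<chi> \<in> T \<sigma> \<longleftrightarrow> (\<exists>g\<in>level k. \<chi> \<in> T (\<sigma>(z := g)))" if "Ex z \<chi> \<in> \<Gamma>"
  proof -
    have "Ex z \<chi> \<in> T \<sigma> \<longleftrightarrow> (\<exists>t\<in>(\<lambda>d. tp w ((h \<circ> \<sigma>)(z := d))) ` dom_at M w. \<chi> \<in> t)"
      unfolding T\<sigma> bex_simps in_tp using that by (simp add: tp_def)
    then show ?thesis unfolding types[symmetric] bex_simps .
  qed
  show "All z \<chi> \<in> T \<sigma> \<longleftrightarrow> (\<forall>g\<in>level k. \<chi> \<in> T (\<sigma>(z := g)))" if "All z \<chi> \<in> \<Gamma>"
  proof -
    have "All z \<chi> \<in> T \<sigma> \<longleftrightarrow> (\<forall>t\<in>(\<lambda>d. tp w ((h \<circ> \<sigma>)(z := d))) ` dom_at M w. \<chi> \<in> t)"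
      unfolding T\<sigma> ball_simps in_tp using that by (simp add: tp_def)
    then show ?thesis unfolding types[symmetric] ball_simps .
  qed
qed

text \<open>The successor \<open>u\<close> is copied by building a type world over it in which the
  agents of level \<open>k\<close> are related as their images under \<open>h\<close>. At
  \<open>w\<close> the map \<open>h\<close> is known to keep types only for pairs containing
  \<open>e\<close>, and \<open>type_acc\<close> asks about no others.\<close>

lemma successor_exists:
  assumes T: "(k, T) \<in> type_worlds" and k: "k < modal_depth \<theta>" and e: "e \<in> level k"
    and w: "mirrors k T w"
    and h: "h ` level k \<subseteq> dom_at M w"
      "\<And>\<sigma> z. range \<sigma> \<subseteq> level k \<Longrightarrow> \<sigma> z = e \<Longrightarrow> T \<sigma> = tp w (h \<circ> \<sigma>)"
    and u: "(w, h e, u) \<in> acc M"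
  obtains U where "((k, T), e, (Suc k, U)) \<in> type_acc"
    "\<And>\<sigma>. range \<sigma> \<subseteq> level k \<Longrightarrow> U \<sigma> = tp u (h \<circ> \<sigma>)"
proof -
  have uM: "u \<in> worlds M" "dom_at M w \<subseteq> dom_at M u"
    using is_model u unfolding is_model_def by blast+
  \<comment> \<open>Growth of the local domains keeps the images under \<open>h\<close> available at
    \<open>u\<close>; agents of level \<open>Suc k\<close> that are not fresh lie in level
    \<open>k\<close>.\<close>
  have "h g \<in> dom_at M u" if "g \<in> level (Suc k)" "fst g < Suc k" for g
  proof -
    have "g \<in> level k" using that by (auto simp: agents_upto_def)
    then show ?thesis using h(1) uM by blast
  qed
  then obtain U where U: "(Suc k, U) \<in> type_worlds"
    "\<And>\<sigma>. range \<sigma> \<subseteq> level (Suc k) \<Longrightarrow> (\<And>z. fst (\<sigma> z) < Suc k) \<Longrightarrow> U \<sigma> = tp u (h \<circ> \<sigma>)"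
    using world_exists[OF uM(1), of "Suc k" h] k by (metis Suc_leI)
  have U\<sigma>: "U \<sigma> = tp u (h \<circ> \<sigma>)" if "range \<sigma> \<subseteq> level k" for \<sigma>
  proof (rule U(2))
    show "range \<sigma> \<subseteq> level (Suc k)" using that agents_upto_mono[of k "Suc k"] by fastforce
    show "fst (\<sigma> z) < Suc k" for z
    proof -
      have "\<sigma> z \<in> level k" using that by auto
      then show ?thesis by (auto simp: agents_upto_def)
    qed
  qed
  have "(Box z \<chi> \<in> T \<sigma> \<longrightarrow> \<chi> \<in> U \<sigma>) \<and> (Dia z \<chi> \<in> \<Gamma> \<longrightarrow> \<chi> \<in> U \<sigma> \<longrightarrow> Dia z \<chi> \<in> T \<sigma>)"
    if \<sigma>: "range \<sigma> \<subseteq> level k" "\<sigma> z = e" for z \<sigma> \<chi>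
  proof (intro conjI impI)
    assume "Box z \<chi> \<in> T \<sigma>"
    then have "Box z \<chi> \<in> \<Gamma>" "sat M w (h \<circ> \<sigma>) (Box z \<chi>)"
      using h(2)[OF \<sigma>] by (auto simp: tp_def)
    moreover from this(1) have "\<chi> \<in> \<Gamma>" by (rule subforms_trans) simp
    ultimately show "\<chi> \<in> U \<sigma>" using u \<sigma> U\<sigma> by (simp add: tp_def)
  next
    assume "Dia z \<chi> \<in> \<Gamma>" "\<chi> \<in> U \<sigma>"
    then show "Dia z \<chi> \<in> T \<sigma>" using h(2)[OF \<sigma>] u \<sigma> U\<sigma> by (auto simp: tp_def)
  qed
  then have "((k, T), e, (Suc k, U)) \<in> type_acc" using T U(1) e by (simp add: type_acc_def)
  then show ?thesis using that U\<sigma> by blast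
qed

text \<open>Soundness of edges is built into \<open>type_acc\<close>. The other two directions copy
  a successor from \<open>M\<close>, which takes a further level: hence
  \<open>k < modal_depth \<theta>\<close>.\<close>

lemma modal_step:
  assumes T: "(k, T) \<in> type_worlds" and k: "k < modal_depth \<theta>" and \<sigma>: "range \<sigma> \<subseteq> level k"
    and \<chi>: "\<chi> \<in> \<Gamma>"
  shows "Dia z \<chi> \<in> \<Gamma> \<Longrightarrow>
      Dia z \<chi> \<in> T \<sigma> \<longleftrightarrow> (\<exists>l U. ((k, T), \<sigma> z, (l, U)) \<in> type_acc \<and> \<chi> \<in> U \<sigma>)" (is "_ \<Longrightarrow> ?D")
    and "Box z \<chi> \<in> \<Gamma> \<Longrightarrow>
      Box z \<chi> \<in> T \<sigma> \<longleftrightarrow> (\<forall>l U. ((k, T), \<sigma> z, (l, U)) \<in> type_acc \<longrightarrow> \<chi> \<in> U \<sigma>)" (is "_ \<Longrightarrow> ?B")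
proof -
  obtain w where w: "mirrors k T w"
    using mirrored_world[OF T] .
  have e: "\<sigma> z \<in> level k" using \<sigma> by auto
  obtain h where h: "h ` level k \<subseteq> dom_at M w"
    "\<And>\<sigma>' y. range \<sigma>' \<subseteq> level k \<Longrightarrow> \<sigma>' y = \<sigma> z \<Longrightarrow> T \<sigma>' = tp w (h \<circ> \<sigma>')"
    by (rule matching_map[OF w e]) blast
  have T\<sigma>: "T \<sigma> = tp w (h \<circ> \<sigma>)" using h(2)[OF \<sigma>] by simp
  have succ: "\<exists>U. ((k, T), \<sigma> z, (Suc k, U)) \<in> type_acc \<and> (\<chi> \<in> U \<sigma> \<longleftrightarrow> sat M u (h \<circ> \<sigma>) \<chi>)"
    if u: "(w, h (\<sigma> z), u) \<in> acc M" for u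
  proof (rule successor_exists[OF T k e w h(1) _ u])
    show "T \<sigma>' = tp w (h \<circ> \<sigma>')" if "range \<sigma>' \<subseteq> level k" "\<sigma>' y = \<sigma> z" for \<sigma>' y
      using that by (rule h(2))
  next
    fix U assume "((k, T), \<sigma> z, (Suc k, U)) \<in> type_acc" "\<And>\<tau>. range \<tau> \<subseteq> level k \<Longrightarrow> U \<tau> = tp u (h \<circ> \<tau>)"
    then show ?thesis using \<sigma> \<chi> by (auto simp: tp_def)
  qed
  show ?D if D: "Dia z \<chi> \<in> \<Gamma>"
  proof
    assume "Dia z \<chi> \<in> T \<sigma>"
    then obtain u where "(w, h (\<sigma> z), u) \<in> acc M" "sat M u (h \<circ> \<sigma>) \<chi>"
      unfolding T\<sigma> by (auto simp: tp_def)
    then show "\<exists>l U. ((k, T), \<sigma> z, (l, U)) \<in> type_acc \<and> \<chi> \<in> U \<sigma>" using succ by blast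
  next
    assume "\<exists>l U. ((k, T), \<sigma> z, (l, U)) \<in> type_acc \<and> \<chi> \<in> U \<sigma>"
    then show "Dia z \<chi> \<in> T \<sigma>" using D \<sigma> by (auto simp: type_acc_def)
  qed
  show ?B if B: "Box z \<chi> \<in> \<Gamma>"
  proof
    assume "Box z \<chi> \<in> T \<sigma>"
    then show "\<forall>l U. ((k, T), \<sigma> z, (l, U)) \<in> type_acc \<longrightarrow> \<chi> \<in> U \<sigma>"
      using \<sigma> by (auto simp: type_acc_def)
  next
    assume *: "\<forall>l U. ((k, T), \<sigma> z, (l, U)) \<in> type_acc \<longrightarrow> \<chi> \<in> U \<sigma>"
    then have "sat M w (h \<circ> \<sigma>) (Box z \<chi>)" using succ by fastforce
    then show "Box z \<chi> \<in> T \<sigma>" unfolding T\<sigma> using B by (simp add: tp_def)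
  qed
qed

text \<open>The inequality reserves one level for each modality still to be crossed, so a box or
  diamond is met only where \<open>modal_step\<close> applies.\<close>

lemma truth_lemma:
  assumes "(k, T) \<in> type_worlds" "range \<sigma> \<subseteq> level k" "\<chi> \<in> \<Gamma>" "k + modal_depth \<chi> \<le> modal_depth \<theta>"
  shows "\<chi> \<in> T \<sigma> \<longleftrightarrow> sat type_model (k, T) \<sigma> \<chi>"
  using assms
proof (induction \<chi> arbitrary: k T \<sigma>)
  case (Prop p)
  obtain w where w: "mirrors k T w"
    using mirrored_world[OF Prop.prems(1)] .
  have "Prop p \<in> T \<tau> \<longleftrightarrow> p \<in> val M w" if "range \<tau> \<subseteq> level k" for \<tau>
    using mirrors_realises[OF w that] Prop.prems(3) by (metis (no_types, lifting) mem_Collect_eq sat.simps(1) tp_def)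
  then show ?case using Prop.prems(2) by (auto simp: type_model_def)
next
  case (Neg \<chi>)
  have "\<chi> \<in> \<Gamma>" using Neg.prems(3) by (rule subforms_trans) simp
  moreover obtain w where w: "mirrors k T w"
    using mirrored_world[OF Neg.prems(1)] .
  obtain \<tau> where "T \<sigma> = tp w \<tau>" using mirrors_realises[OF w Neg.prems(2)] .
  ultimately show ?case using Neg by (auto simp: tp_def)
next
  case (And \<chi> \<psi>)
  have "\<chi> \<in> \<Gamma>" "\<psi> \<in> \<Gamma>" by (rule subforms_trans[OF And.prems(3)], simp)+
  moreover obtain w where w: "mirrors k T w"
    using mirrored_world[OF And.prems(1)] .
  obtain \<tau> where "T \<sigma> = tp w \<tau>" using mirrors_realises[OF w And.prems(2)] .
  ultimately have "And \<chi> \<psi> \<in> T \<sigma> \<longleftrightarrow> \<chi> \<in> T \<sigma> \<and> \<psi> \<in> T \<sigma>"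
    using And.prems(3) by (simp add: tp_def)
  then show ?case using And.IH[of k T \<sigma>] And.prems \<open>\<chi> \<in> \<Gamma>\<close> \<open>\<psi> \<in> \<Gamma>\<close> by simp
next
  case (Or \<chi> \<psi>)
  have "\<chi> \<in> \<Gamma>" "\<psi> \<in> \<Gamma>" by (rule subforms_trans[OF Or.prems(3)], simp)+
  moreover obtain w where w: "mirrors k T w"
    using mirrored_world[OF Or.prems(1)] .
  obtain \<tau> where "T \<sigma> = tp w \<tau>" using mirrors_realises[OF w Or.prems(2)] .
  ultimately have "Or \<chi> \<psi> \<in> T \<sigma> \<longleftrightarrow> \<chi> \<in> T \<sigma> \<or> \<psi> \<in> T \<sigma>"
    using Or.prems(3) by (simp add: tp_def)
  then show ?case using Or.IH[of k T \<sigma>] Or.prems \<open>\<chi> \<in> \<Gamma>\<close> \<open>\<psi> \<in> \<Gamma>\<close> by simp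
next
  case (Ex z \<chi>)
  have \<chi>: "\<chi> \<in> \<Gamma>" using Ex.prems(3) by (rule subforms_trans) simp
  have "\<chi> \<in> T (\<sigma>(z := g)) \<longleftrightarrow> sat type_model (k, T) (\<sigma>(z := g)) \<chi>" if "g \<in> level k" for g
    by (rule Ex.IH) (use Ex.prems \<chi> that in auto)
  then show ?case
    using quantifier_step(1)[OF Ex.prems(1,2) \<chi> Ex.prems(3)]
    by (simp add: type_model_simps del: fun_upd_apply)
next
  case (All z \<chi>)
  have \<chi>: "\<chi> \<in> \<Gamma>" using All.prems(3) by (rule subforms_trans) simp
  have "\<chi> \<in> T (\<sigma>(z := g)) \<longleftrightarrow> sat type_model (k, T) (\<sigma>(z := g)) \<chi>" if "g \<in> level k" for g
    by (rule All.IH) (use All.prems \<chi> that in auto)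
  then show ?case
    using quantifier_step(2)[OF All.prems(1,2) \<chi> All.prems(3)]
    by (simp add: type_model_simps del: fun_upd_apply)
next
  case (Box z \<chi>)
  have \<chi>: "\<chi> \<in> \<Gamma>" using Box.prems(3) by (rule subforms_trans) simp
  have "\<chi> \<in> U \<sigma> \<longleftrightarrow> sat type_model (l, U) \<sigma> \<chi>" if "((k, T), \<sigma> z, (l, U)) \<in> type_acc" for l U
    by (rule Box.IH) (use Box.prems \<chi> that agents_upto_mono[of k "Suc k"] in \<open>auto simp: type_acc_def\<close>)
  moreover have "k < modal_depth \<theta>" using Box.prems(4) by simp
  ultimately show ?case
    using modal_step(2)[OF Box.prems(1) _ Box.prems(2) \<chi> Box.prems(3)]
    by (simp add: type_model_simps)
next
  case (Dia z \<chi>)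
  have \<chi>: "\<chi> \<in> \<Gamma>" using Dia.prems(3) by (rule subforms_trans) simp
  have "\<chi> \<in> U \<sigma> \<longleftrightarrow> sat type_model (l, U) \<sigma> \<chi>" if "((k, T), \<sigma> z, (l, U)) \<in> type_acc" for l U
    by (rule Dia.IH) (use Dia.prems \<chi> that agents_upto_mono[of k "Suc k"] in \<open>auto simp: type_acc_def\<close>)
  moreover have "k < modal_depth \<theta>" using Dia.prems(4) by simp
  ultimately show ?case
    using modal_step(1)[OF Dia.prems(1) _ Dia.prems(2) \<chi> Dia.prems(3)]
    by (simp add: type_model_simps cong: conj_cong)
qed

lemma type_model_satisfies:
  assumes "satisfied_in M \<theta>" "sentence \<theta>"
  shows "is_model type_model \<and> satisfied_in type_model \<theta>"
proof -
  obtain w \<sigma> where w: "w \<in> worlds M" "sat M w \<sigma> \<theta>"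
    using assms(1) by (auto simp: satisfied_in_def)
  have sat: "sat M w \<tau> \<theta>" for \<tau>
    using w(2) assms(2) sat_fv_cong[of \<theta> \<sigma> \<tau> M w] by (auto simp: sentence_def)
  \<comment> \<open>At level 0 there are no older agents, so the map prescribed in
    \<open>world_exists\<close> is vacuous. The assignment used below is constant, where the value
    of \<open>T\<close> is known.\<close>
  obtain T h where T: "(0, T) \<in> type_worlds" "\<And>e. e \<in> level 0 \<Longrightarrow> T (\<lambda>_. e) = tp w (\<lambda>_. h e)"
    using world_exists[OF w(1), of 0] by (metis less_nat_zero_code zero_le)
  obtain e where e: "e \<in> level 0" using level_nonempty[of 0] by blast
  then have "\<theta> \<in> T (\<lambda>_. e)" using T(2) sat by (simp add: tp_def)
  then have "sat type_model (0, T) (\<lambda>_. e) \<theta>"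
    using truth_lemma[OF T(1), of "\<lambda>_. e" \<theta>] e by auto
  moreover have "e \<in> level (modal_depth \<theta>)" using e agents_upto_mono[of 0 "modal_depth \<theta>"] by blast
  ultimately have sat': "satisfied_in type_model \<theta>"
    unfolding satisfied_in_def using T(1)
    by (intro bexI[of _ "(0, T)"] exI[of _ "\<lambda>_. e"]) (auto simp: type_model_def)
  have acc: "(k, U) \<in> type_worlds" "(l, V) \<in> type_worlds" "a \<in> level k" "level k \<subseteq> level l"
    if "((k, U), a, (l, V)) \<in> type_acc" for k U a l V
    using that agents_upto_mono[of k "Suc k"] by (auto simp: type_acc_def)
  have D: "level k \<subseteq> level (modal_depth \<theta>)" if "(k, U) \<in> type_worlds" for k U
    using that by (intro agents_upto_mono) (simp add: type_worlds_def)
  have "is_model type_model"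
    unfolding is_model_def type_model_simps
  proof (intro conjI ballI allI impI)
    show "type_worlds \<noteq> {}" using T(1) by blast
    show "countable type_worlds" using finite_type_worlds by (rule countable_finite)
    show "level (modal_depth \<theta>) \<noteq> {}" by (rule level_nonempty)
    show "countable (level (modal_depth \<theta>))" by (simp add: countable_finite finite_agents_upto)
    show "type_acc \<subseteq> type_worlds \<times> level (modal_depth \<theta>) \<times> type_worlds"
    proof
      fix x assume x: "x \<in> type_acc"
      obtain k U a l V where xe: "x = ((k, U), a, (l, V))" by (metis surj_pair)
      have "(k, U) \<in> type_worlds" "(l, V) \<in> type_worlds" "a \<in> level k" using acc x xe by blast+
      then show "x \<in> type_worlds \<times> level (modal_depth \<theta>) \<times> type_worlds"
        unfolding xe using D by blast
    qed
  next
    fix u assume "u \<in> type_worlds"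
    then show "dom_at type_model u \<noteq> {}" "dom_at type_model u \<subseteq> level (modal_depth \<theta>)"
      using level_nonempty D by (cases u, simp add: type_model_simps)+
  next
    fix u a v assume "(u, a, v) \<in> type_acc"
    then show "a \<in> dom_at type_model u" "dom_at type_model u \<subseteq> dom_at type_model v"
      using acc by (cases u, cases v, simp only: type_model_simps)+
  qed
  then show ?thesis using sat' by blast
qed

end

section \<open>The bound on the number of agents\<close>

theorem theorem1:
  "\<exists>B :: 'p form \<Rightarrow> nat. \<forall>\<theta>. sentence \<theta> \<and> fsnf_dnf \<theta> \<longrightarrow>
     (satisfiable \<theta> \<longleftrightarrow> satisfiable_agents_le (B \<theta>) \<theta>)"
proof -
  \<comment> \<open>\<open>B\<close> arises by choosing such an \<open>n\<close> for each \<theta>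
    separately; for an unsatisfiable \<theta> every \<open>n\<close> works.\<close>
  have "\<exists>n. satisfiable \<theta> \<longleftrightarrow> satisfiable_agents_le n \<theta>" if closed: "sentence \<theta>" for \<theta> :: "'p form"
  proof (cases "satisfiable \<theta>")
    case True
    then obtain M :: "(nat, nat, 'p) model" where M: "is_model M" "satisfied_in M \<theta>"
      by (auto simp: satisfiable_def)
    then interpret finite_agents M \<theta> by unfold_locales
    \<comment> \<open>Passing to natural numbers keeps the set of agents up to bijection, hence
      finite.\<close>
    obtain N :: "(nat, nat, 'p) model" where N: "is_model N" "satisfied_in N \<theta>"
      "bij_betw (to_nat_on (agents type_model)) (agents type_model) (agents N)"
      using nat_model_exists type_model_satisfies[OF M(2) closed] by blast
    have "finite (agents type_model)" by (simp add: type_model_def finite_agents_upto)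
    then have "finite (agents N)" using N(3) bij_betw_finite by blast
    then have "satisfiable_agents_le (card (agents N)) \<theta>"
      unfolding satisfiable_agents_le_def using N(1,2) by blast
    then show ?thesis using True by blast
  next
    case False
    then show ?thesis unfolding satisfiable_def satisfiable_agents_le_def by blast
  qed
  then show ?thesis by metis
qed

end
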